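(* Let $(X,d)$ be a compact metric space, let $f:X\to X$ be a homeomorphism, and let $N\ge 1$ be an integer. If $f$ is $N$-equicontinuous, then $f$ is $N$-distal.
   Context: For $x\in X$, the proximal cell of $x$ is $P(x)=\{y\in X : \inf_{n\in\mathbb{Z}} d(f^n(x),f^n(y))=0\}$. The homeomorphism $f$ is $N$-distal if $P(x)$ has at most $N$ points for every $x\in X$. For a subset $A\subseteq X$, the $N$-diameter of $A$ is $$\mathrm{diam}_N(A)=\sup\Big\{\min\{d(x,y) : x,y\in B,\ x\ne y\} : B\subseteq A,\ \#B=N+1\Big\},$$ with the convention that it equals $0$ if $A$ has at most $N$ elements. For $x\in X$ and $\delta>0$, $R_\delta(x)=\{y\in X : d(f^i(y),f^i(x))<\delta \text{ for some } i\in\mathbb{Z}\}$. The homeomorphism $f$ is $N$-equicontinuous if for every $\varepsilon>0$ there exists $\delta>0$ such that $\mathrm{diam}_N(f^n(R_\delta(x)))<\varepsilon$ for all $x\in X$ and all $n\in\mathbb{Z}$. *)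

theory Defs
  imports "HOL-Analysis.Analysis"
begin

text \<open>The compact metric space is a compact set \<open>X\<close> in a type of class \<open>metric_space\<close>, with the
  induced metric \<open>dist\<close>. Maps are total functions on the type, of which only the values on \<open>X\<close>
  matter.\<close>

text \<open>The iterate \<open>f\<^sup>n\<close>, \<open>n \<in> \<int>\<close>, of a bijection \<open>f\<close> of \<open>X\<close> onto itself; meaningful only at points
  of \<open>X\<close>.\<close>

definition int_iter :: "'a set \<Rightarrow> ('a \<Rightarrow> 'a) \<Rightarrow> int \<Rightarrow> 'a \<Rightarrow> 'a" where
  "int_iter X f n = (if n \<ge> 0 then f ^^ nat n else inv_into X f ^^ nat (- n))"

definition proximal_cell :: "'a::metric_space set \<Rightarrow> ('a \<Rightarrow> 'a) \<Rightarrow> 'a \<Rightarrow> 'a set" where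
  "proximal_cell X f x = {y \<in> X. (INF n. dist (int_iter X f n x) (int_iter X f n y)) = 0}"

definition N_distal :: "nat \<Rightarrow> 'a::metric_space set \<Rightarrow> ('a \<Rightarrow> 'a) \<Rightarrow> bool" where
  "N_distal N X f \<longleftrightarrow>
     (\<forall>x\<in>X. finite (proximal_cell X f x) \<and> card (proximal_cell X f x) \<le> N)"

text \<open>The supremum is taken in \<open>real\<close>, so the value is meaningful for \<open>N \<ge> 1\<close> and bounded \<open>A\<close>, which
  holds for every subset of a compact space. If \<open>A\<close> has at most \<open>N\<close> points, the set of minima is
  empty, hence the explicit case.\<close>

definition N_diameter :: "nat \<Rightarrow> 'a::metric_space set \<Rightarrow> real" where
  "N_diameter N A =
     (if finite A \<and> card A \<le> N then 0
      else Sup {Min {dist x y | x y. x \<in> B \<and> y \<in> B \<and> x \<noteq> y} | B. B \<subseteq> A \<and> card B = N + 1})"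

definition orbit_nbhd :: "'a::metric_space set \<Rightarrow> ('a \<Rightarrow> 'a) \<Rightarrow> real \<Rightarrow> 'a \<Rightarrow> 'a set" where
  "orbit_nbhd X f \<delta> x = {y \<in> X. \<exists>i. dist (int_iter X f i y) (int_iter X f i x) < \<delta>}"

definition N_equicontinuous :: "nat \<Rightarrow> 'a::metric_space set \<Rightarrow> ('a \<Rightarrow> 'a) \<Rightarrow> bool" where
  "N_equicontinuous N X f \<longleftrightarrow>
     (\<forall>\<epsilon>>0. \<exists>\<delta>>0. \<forall>x\<in>X. \<forall>n. N_diameter N (int_iter X f n ` orbit_nbhd X f \<delta> x) < \<epsilon>)"

end

theory Submission
  imports Defs
begin

text \<open>A point proximal to \<open>x\<close> comes arbitrarily close to \<open>x\<close> along
  the orbit, so the proximal cell lies in \<open>orbit_nbhd X f \<delta> x\<close> for every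
  \<delta> > 0 (\<open>proximal_cell_subset_orbit_nbhd\<close>). If the cell contained N + 1 points,
  their least mutual distance would be a positive number independent of \<delta>
  (\<open>pairwise_dist_Min_pos\<close>) and a lower bound for the N-diameter of all these
  neighbourhoods (\<open>pairwise_dist_Min_le_N_diameter\<close>). N-equicontinuity at time 0
  forbids this.\<close>

lemma proximal_cell_subset_orbit_nbhd:
  assumes "\<delta> > 0"
  shows "proximal_cell X f x \<subseteq> orbit_nbhd X f \<delta> x"
proof
  fix y assume y: "y \<in> proximal_cell X f x"
  let ?D = "\<lambda>n. dist (int_iter X f n x) (int_iter X f n y)"
  have "\<exists>n. ?D n < \<delta>"
  proof (rule ccontr)
    assume "\<nexists>n. ?D n < \<delta>"
    then have "\<delta> \<le> (INF n. ?D n)"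
      by (intro cINF_greatest) (auto simp: not_less)
    with y assms show False
      by (simp add: proximal_cell_def)
  qed
  with y show "y \<in> orbit_nbhd X f \<delta> x"
    by (auto simp: proximal_cell_def orbit_nbhd_def dist_commute)
qed

lemma finite_pairwise_dists:
  assumes "finite B"
  shows "finite {dist x y | x y. x \<in> B \<and> y \<in> B \<and> x \<noteq> y}"
proof (rule finite_subset)
  show "{dist x y | x y. x \<in> B \<and> y \<in> B \<and> x \<noteq> y} \<subseteq> (\<lambda>(x, y). dist x y) ` (B \<times> B)"
    by auto
qed (use assms in simp)

lemma ex_distinct_of_card_Suc:
  assumes "card B = N + 1" and "N \<ge> 1"
  obtains x y where "x \<in> B" "y \<in> B" "x \<noteq> y"
proof -
  obtain x where x: "x \<in> B"
    using assms by fastforce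
  moreover have "\<not> B \<subseteq> {x}"
    using assms card_mono[of "{x}" B] by auto
  ultimately show ?thesis
    using that by auto
qed

text \<open>Since N \<ge> 1, the set has two distinct points, so the minimum is over a finite
  nonempty set of positive distances.\<close>

lemma pairwise_dist_Min_pos:
  assumes "card B = N + 1" and "N \<ge> 1"
  shows "Min {dist x y | x y. x \<in> B \<and> y \<in> B \<and> x \<noteq> y} > 0"
proof -
  have "finite B"
    using assms by (simp add: card_ge_0_finite)
  moreover obtain x y where "x \<in> B" "y \<in> B" "x \<noteq> y"
    using ex_distinct_of_card_Suc assms by blast
  ultimately show ?thesis
    by (subst Min_gr_iff[OF finite_pairwise_dists]) auto
qed

text \<open>A real \<open>Sup\<close> dominates its members once they are bounded above; here each
  minimum is at most an actual distance in \<open>A\<close>, hence at most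
  \<open>diameter A\<close>.\<close>

lemma pairwise_dist_Min_le_N_diameter:
  assumes "bounded A" and "B \<subseteq> A" and "card B = N + 1" and "N \<ge> 1"
  shows "Min {dist x y | x y. x \<in> B \<and> y \<in> B \<and> x \<noteq> y} \<le> N_diameter N A"
proof -
  let ?m = "\<lambda>B. Min {dist x y | x y. x \<in> B \<and> y \<in> B \<and> x \<noteq> y}"
  have "?m C \<le> diameter A" if C: "C \<subseteq> A" "card C = N + 1" for C
  proof -
    obtain x y where xy: "x \<in> C" "y \<in> C" "x \<noteq> y"
      using ex_distinct_of_card_Suc C assms(4) by blast
    have "finite C"
      using C by (simp add: card_ge_0_finite)
    then have "?m C \<le> dist x y"
      using xy finite_pairwise_dists by (intro Min_le) auto
    also have "\<dots> \<le> diameter A"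
      using diameter_bounded_bound[OF assms(1)] xy C(1) by blast
    finally show ?thesis .
  qed
  then have "bdd_above {?m B | B. B \<subseteq> A \<and> card B = N + 1}"
    by (auto intro!: bdd_aboveI[where M = "diameter A"])
  then have "?m B \<le> Sup {?m B | B. B \<subseteq> A \<and> card B = N + 1}"
    using assms(2,3) by (intro cSup_upper) auto
  \<comment> \<open>The N + 1 points of \<open>B\<close> exclude the case in which
    \<open>N_diameter\<close> is 0 by convention.\<close>
  moreover have "\<not> (finite A \<and> card A \<le> N)"
    using card_mono[of A B] assms(2,3) by auto
  ultimately show ?thesis
    unfolding N_diameter_def by (simp only: if_False)
qed

theorem theorem2p13:
  fixes X :: "'a::metric_space set" and f :: "'a \<Rightarrow> 'a" and N :: nat
  assumes "compact X"
    and "\<exists>g. homeomorphism X X f g"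
    and "N \<ge> 1"
    and "N_equicontinuous N X f"
  shows "N_distal N X f"
proof (rule ccontr)
  assume "\<not> N_distal N X f"
  then obtain x where x: "x \<in> X"
    and large: "\<not> (finite (proximal_cell X f x) \<and> card (proximal_cell X f x) \<le> N)"
    by (auto simp: N_distal_def)
  \<comment> \<open>Failure of the bound includes an infinite cell, whose \<open>card\<close> is 0,
    so that case is separate.\<close>
  have "\<exists>B \<subseteq> proximal_cell X f x. card B = N + 1"
  proof (cases "finite (proximal_cell X f x)")
    case True
    with large have "N + 1 \<le> card (proximal_cell X f x)"
      by linarith
    then show ?thesis
      by (rule obtain_subset_with_card_n) auto
  next
    case False
    then show ?thesis
      using infinite_arbitrarily_large[of _ "N + 1"] by metis
  qed
  then obtain B where B: "B \<subseteq> proximal_cell X f x" "card B = N + 1"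
    by blast
  \<comment> \<open>The separation of \<open>B\<close> is fixed before \<delta> is chosen.\<close>
  let ?\<epsilon> = "Min {dist x y | x y. x \<in> B \<and> y \<in> B \<and> x \<noteq> y}"
  have "?\<epsilon> > 0"
    by (rule pairwise_dist_Min_pos[OF B(2) assms(3)])
  then obtain \<delta> where "\<delta> > 0"
    and \<delta>: "\<forall>x\<in>X. \<forall>n. N_diameter N (int_iter X f n ` orbit_nbhd X f \<delta> x) < ?\<epsilon>"
    using assms(4) unfolding N_equicontinuous_def by blast
  have "N_diameter N (int_iter X f 0 ` orbit_nbhd X f \<delta> x) < ?\<epsilon>"
    using \<delta> x by blast
  then have "N_diameter N (orbit_nbhd X f \<delta> x) < ?\<epsilon>"
    by (simp add: int_iter_def)
  moreover have "B \<subseteq> orbit_nbhd X f \<delta> x"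
    using B(1) proximal_cell_subset_orbit_nbhd[OF \<open>\<delta> > 0\<close>] by blast
  \<comment> \<open>Compactness of \<open>X\<close> supplies the boundedness that keeps the supremum
    meaningful.\<close>
  moreover have "bounded (orbit_nbhd X f \<delta> x)"
    by (rule bounded_subset[OF compact_imp_bounded[OF assms(1)]]) (auto simp: orbit_nbhd_def)
  ultimately show False
    using pairwise_dist_Min_le_N_diameter[OF _ _ B(2) assms(3)] by (simp only: not_less[symmetric])
qed

end
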